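(* Let $q\ge 3$ be odd. If $q$ is a composite number, then $F_q$ does not have any cycle in the congruent classes $h=md$, where $d$ is any divisor of $q$ different from $1$ and $q$, and $m\in\mathbb Z^+$ is any multiplier such that $md\le q-1$.
   Context: $\mathbb Z^+$ is the set of positive integers and $\mathbb N=\{0,1,2,\ldots\}$. For odd $q\ge 3$ let $X_q(n)=2(q-1)n+1$ for $n\in\mathbb Z^+$, and let $\mathbb Z_{cq}=X_q(\mathbb Z^+)=\{x\in\mathbb Z^+ : x\equiv 1 \bmod 2(q-1),\ x>1\}$. For $x\in\mathbb Z_{cq}$ let $\alpha_q(x)=1$ if $x-1\equiv 2(q-1) \pmod{4(q-1)}$ and $\alpha_q(x)=0$ if $x-1\equiv 0\pmod{4(q-1)}$, and define $F_q:\mathbb Z_{cq}\to\mathbb Z_{cq}$ by $F_q(x)=\frac{q^{\alpha_q(x)}}{2}(x+1)$. A cycle of $F_q$ of period $p\in\mathbb Z^+$ is a periodic sequence $\{x_0,x_1,\ldots,x_{p-1}\}$ in $\mathbb Z_{cq}$ with $x_j=F_q^j(x_0)$ and $x_{j+p}=x_j$, where $p$ is the minimum possible period and the seed $x_0$ is, by convention, the minimum element of the cycle. For $h\in\{1,\ldots,q-1\}$, a cycle is in the congruent class $h$ if its seed is $x_0=X_q(h+\lambda_h q)$ for some $\lambda_h\in\mathbb N$. *)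

theory Defs
  imports "HOL-Number_Theory.Cong" "HOL-Computational_Algebra.Primes"
begin

definition Xq :: "nat \<Rightarrow> nat \<Rightarrow> nat" where
  "Xq q n = 2 * (q - 1) * n + 1"

definition Zcq :: "nat \<Rightarrow> nat set" where
  "Zcq q = Xq q ` {n. n \<ge> 1}"

lemma Zcq_iff_cong:
  assumes "q \<ge> 3"
  shows "x \<in> Zcq q \<longleftrightarrow> x > 1 \<and> [x = 1] (mod (2 * (q - 1)))"
proof
  assume "x \<in> Zcq q"
  then obtain n where "n \<ge> 1" "x = 2 * (q - 1) * n + 1"
    by (auto simp: Zcq_def Xq_def)
  then show "x > 1 \<and> [x = 1] (mod (2 * (q - 1)))"
    using assms by (simp add: cong_altdef_nat)
next
  assume x: "x > 1 \<and> [x = 1] (mod (2 * (q - 1)))"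
  then have "2 * (q - 1) dvd x - 1"
    using cong_altdef_nat[of 1 x "2 * (q - 1)"] by auto
  then obtain n where n: "x - 1 = 2 * (q - 1) * n" ..
  with x have "n \<ge> 1" by (cases n) auto
  moreover have "x = Xq q n" unfolding Xq_def n[symmetric] using x by simp
  ultimately show "x \<in> Zcq q" by (auto simp: Zcq_def)
qed

definition alphaq :: "nat \<Rightarrow> nat \<Rightarrow> nat" where
  "alphaq q x = (if [x - 1 = 2 * (q - 1)] (mod (4 * (q - 1))) then 1 else 0)"

lemma alphaq_eq_0_iff:
  assumes "q \<ge> 3" "x \<in> Zcq q"
  shows "alphaq q x = 0 \<longleftrightarrow> [x - 1 = 0] (mod (4 * (q - 1)))"
proof -
  obtain n where x: "x = Xq q n" using assms by (auto simp: Zcq_def)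
  have eq: "x - 1 = (2 * (q - 1)) * n" "4 * (q - 1) = (2 * (q - 1)) * 2"
    by (simp_all add: x Xq_def)
  have "(x - 1) mod (4 * (q - 1)) = (2 * (q - 1)) * (n mod 2)"
    unfolding eq by (rule mult_mod_right[symmetric])
  with assms(1) show ?thesis
    by (cases "even n") (auto simp: alphaq_def cong_def even_iff_mod_2_eq_zero odd_iff_mod_2_eq_one)
qed

(* The division is exact on Zcq q, whose elements are odd; see two_times_Fq. *)
definition Fq :: "nat \<Rightarrow> nat \<Rightarrow> nat" where
  "Fq q x = q ^ alphaq q x * (x + 1) div 2"

lemma two_times_Fq: "x \<in> Zcq q \<Longrightarrow> 2 * Fq q x = q ^ alphaq q x * (x + 1)"
  by (auto simp: Zcq_def Xq_def Fq_def)

lemma Fq_in_Zcq: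
  assumes "odd q" "q \<ge> 3" "x \<in> Zcq q"
  shows "Fq q x \<in> Zcq q"
proof -
  obtain n where n: "n \<ge> 1" "x = Xq q n" using assms by (auto simp: Zcq_def)
  obtain r where q: "q = r + 1" "r \<ge> 2"
    using assms(2) by (intro that[of "q - 1"]) auto
  have eq: "x - 1 = (2 * r) * n" "4 * r = (2 * r) * 2"
    by (simp_all add: n Xq_def q)
  have m: "(x - 1) mod (4 * r) = (2 * r) * (n mod 2)"
    unfolding eq by (rule mult_mod_right[symmetric])
  show ?thesis
  proof (cases "even n")
    case True
    then obtain k where k: "n = 2 * k" ..
    have "alphaq q x = 0" using True m q by (simp add: alphaq_def cong_def)
    then have "Fq q x = Xq q k" by (simp add: Fq_def n Xq_def k q)
    with k n show ?thesis by (auto simp: Zcq_def)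
  next
    case False
    then have "even (q * n + 1)" using assms(1) by simp
    then obtain k where k: "q * n + 1 = 2 * k" ..
    have "alphaq q x = 1" using False m q by (simp add: alphaq_def cong_def odd_iff_mod_2_eq_one)
    then have "2 * Fq q x = q * (x + 1)" using two_times_Fq[OF assms(3)] by simp
    also have "\<dots> = 2 * (r * (q * n + 1) + 1)" by (simp add: n Xq_def q algebra_simps)
    also have "\<dots> = 2 * Xq q k" unfolding k by (simp add: Xq_def q)
    finally have "Fq q x = Xq q k" by simp
    moreover have "k \<ge> 1" using k by (cases k) auto
    ultimately show ?thesis by (auto simp: Zcq_def)
  qed
qed

(* A cycle is represented by the infinite p-periodic sequence x extending x_0, ..., x_{p-1};
   the last conjunct is the convention that the seed x 0 is the minimum of the cycle. *)
definition is_cycle :: "nat \<Rightarrow> nat \<Rightarrow> (nat \<Rightarrow> nat) \<Rightarrow> bool" where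
  "is_cycle q p x \<longleftrightarrow>
     p \<ge> 1 \<and>
     (\<forall>j. x j \<in> Zcq q) \<and>
     (\<forall>j. x j = (Fq q ^^ j) (x 0)) \<and>
     (\<forall>j. x (j + p) = x j) \<and>
     (\<forall>r. 1 \<le> r \<and> r < p \<longrightarrow> \<not> (\<forall>j. x (j + r) = x j)) \<and>
     (\<forall>j. x 0 \<le> x j)"

definition in_congruent_class :: "nat \<Rightarrow> nat \<Rightarrow> (nat \<Rightarrow> nat) \<Rightarrow> bool" where
  "in_congruent_class q h x \<longleftrightarrow> h \<in> {1..q - 1} \<and> (\<exists>l. x 0 = Xq q (h + l * q))"

end

theory Submission
  imports Defs
begin

text \<open>
  Write every element of the cycle as \<open>Xq q n\<close>. On the indices \<open>n\<close>, the map \<open>Fq q\<close> is the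
  generalised Collatz map: it sends \<open>n\<close> to \<open>n / 2\<close> or to \<open>(q * n + 1) / 2\<close>
  (lemma \<open>Fq_on_indices\<close>). Let \<open>d \<noteq> 1\<close> divide \<open>q\<close>. An image \<open>b = (q * n + 1) / 2\<close> satisfies
  \<open>2 * b \<equiv> 1\<close> modulo \<open>d\<close>, so it is not a multiple of \<open>d\<close>. Hence the only predecessor of a
  multiple \<open>b\<close> of \<open>d\<close> is \<open>2 * b\<close>, which is again a multiple of \<open>d\<close>
  (lemma \<open>predecessor_of_multiple\<close>). If the index \<open>b\<close> of the seed were a multiple of \<open>d\<close>,
  walking once backwards around the cycle, of period \<open>p\<close>, would therefore give
  \<open>b = 2 ^ p * b\<close>, which is absurd for \<open>b > 0\<close> (lemma \<open>seed_index_not_multiple\<close>). But the seed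
  of a cycle in the class \<open>m * d\<close> has index \<open>m * d + l * q\<close>, a multiple of \<open>d\<close>.
\<close>

lemma Fq_on_indices:
  assumes "q > 1" and "a \<ge> 1" and step: "Fq q (Xq q a) = Xq q b"
  shows "2 * b = a \<or> 2 * b = q * a + 1"
proof -
  obtain r where q: "q = r + 1" and "r > 0"
    using assms(1) by (intro that[of "q - 1"]) auto
  have "Xq q a \<in> Zcq q" using assms(2) by (auto simp: Zcq_def)
  from two_times_Fq[OF this]
  have eq: "2 * Xq q b = q ^ alphaq q (Xq q a) * (Xq q a + 1)" by (simp add: step)
  have "alphaq q (Xq q a) = 0 \<or> alphaq q (Xq q a) = 1" by (simp add: alphaq_def)
  then show ?thesis
  proof
    assume "alphaq q (Xq q a) = 0"
    with eq have "2 * Xq q b = Xq q a + 1" by simp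
    then have "r * (2 * b) = r * a" by (auto simp: Xq_def q)
    with \<open>r > 0\<close> show ?thesis by simp
  next
    assume "alphaq q (Xq q a) = 1"
    with eq have "2 * Xq q b = q * (Xq q a + 1)" by simp
    then have "r * (2 * b) = r * (q * a + 1)" by (simp add: Xq_def q algebra_simps)
    with \<open>r > 0\<close> show ?thesis by (metis mult_cancel1 less_irrefl)
  qed
qed

text \<open>
  The odd branch is impossible, since a common divisor of \<open>2 * b\<close> and \<open>q\<close> would divide
  \<open>2 * b - q * a = 1\<close>.
\<close>

lemma predecessor_of_multiple:
  fixes q d a b :: nat
  assumes "2 * b = a \<or> 2 * b = q * a + 1" and "d dvd q" and "d \<noteq> 1" and "d dvd b"
  shows "a = 2 * b"
proof -
  have "2 * b \<noteq> q * a + 1"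
  proof
    assume "2 * b = q * a + 1"
    with \<open>d dvd b\<close> have "d dvd q * a + 1" by (metis dvd_mult)
    moreover have "d dvd q * a" using \<open>d dvd q\<close> by simp
    ultimately have "d dvd 1" by (metis dvd_add_right_iff)
    with \<open>d \<noteq> 1\<close> show False by simp
  qed
  with assms(1) show ?thesis by simp
qed

lemma seed_index_not_multiple:
  assumes cyc: "is_cycle q p x" and seed: "x 0 = Xq q b"
    and "q > 1" and "d dvd q" and "d \<noteq> 1"
  shows "\<not> d dvd b"
proof
  assume "d dvd b"
  from cyc have p: "p \<ge> 1" and Z: "\<And>j. x j \<in> Zcq q"
    and iter: "\<And>j. x j = (Fq q ^^ j) (x 0)" and per: "\<And>j. x (j + p) = x j"
    unfolding is_cycle_def by blast+
  have "\<forall>j. \<exists>n\<ge>1. x j = Xq q n" using Z by (auto simp: Zcq_def)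
  then obtain n where n: "\<And>j. n j \<ge> 1" "\<And>j. x j = Xq q (n j)" by metis
  have Xq_inj: "u = v" if "Xq q u = Xq q v" for u v
    using that \<open>q > 1\<close> by (simp add: Xq_def)
  have n0: "n 0 = b" by (rule Xq_inj) (use seed n(2)[of 0] in simp)
  have np: "n p = b" by (rule Xq_inj) (use per[of 0] n(2)[of p] seed in simp)
  have step: "2 * n (Suc j) = n j \<or> 2 * n (Suc j) = q * n j + 1" for j
  proof (rule Fq_on_indices)
    have "Fq q (x j) = x (Suc j)" using iter[of j] iter[of "Suc j"] by simp
    then show "Fq q (Xq q (n j)) = Xq q (n (Suc j))" by (simp add: n(2))
  qed (use \<open>q > 1\<close> n(1) in auto)
  \<comment> \<open>Being a multiple of \<open>d\<close> propagates along this walk, which forbids the odd branch throughout.\<close>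
  have backwards: "n (p - i) = 2 ^ i * b" if "i \<le> p" for i
    using that
  proof (induction i)
    case 0
    then show ?case by (simp add: np)
  next
    case (Suc i)
    then have IH: "n (p - i) = 2 ^ i * b" by simp
    have "Suc (p - Suc i) = p - i" using Suc.prems by simp
    with step[of "p - Suc i"]
    have "2 * n (p - i) = n (p - Suc i) \<or> 2 * n (p - i) = q * n (p - Suc i) + 1" by simp
    from predecessor_of_multiple[OF this \<open>d dvd q\<close> \<open>d \<noteq> 1\<close>]
    have "n (p - Suc i) = 2 * n (p - i)" using IH \<open>d dvd b\<close> by simp
    with IH show ?case by simp
  qed
  have "b = 2 ^ p * b" using backwards[of p] n0 by simp
  moreover have "b \<ge> 1" using n(1)[of 0] n0 by simp
  moreover have "(2::nat) ^ p > 1" using p by (intro one_less_power) auto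
  ultimately show False by simp
qed

theorem proposition14:
  fixes q d m :: nat
  assumes "odd q" and "q \<ge> 3"
    and "\<not> prime q"
    and "d dvd q" and "d \<noteq> 1" and "d \<noteq> q"
    and "m \<ge> 1" and "m * d \<le> q - 1"
  shows "\<not> (\<exists>p x. is_cycle q p x \<and> in_congruent_class q (m * d) x)"
proof
  assume "\<exists>p x. is_cycle q p x \<and> in_congruent_class q (m * d) x"
  then obtain p x l where "is_cycle q p x" and "x 0 = Xq q (m * d + l * q)"
    by (auto simp: in_congruent_class_def)
  from seed_index_not_multiple[OF this _ \<open>d dvd q\<close> \<open>d \<noteq> 1\<close>]
  have "\<not> d dvd m * d + l * q" using \<open>q \<ge> 3\<close> by simp
  with \<open>d dvd q\<close> show False by simp
qed

end
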